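(* Let $G$ be a finite group of order $n$ with identity $e$, and let $S\subseteq G\setminus\{e\}$ satisfy $S=S^{-1}$, $G=\langle S\rangle$ and $|S|=2$. Then $\gamma_{S}(\mathrm{Cay}(S:G))=n-4$ if and only if $G$ is isomorphic to one of $\mathbb{Z}_6$, $\mathbb{Z}_7$, $\mathbb{Z}_8$, $S_3$, $D_8$.
   Context: $\mathrm{Cay}(S:G)$ is the simple graph with vertex set $G$ in which $a$ and $b$ are adjacent if and only if $ab^{-1}\in S$. For a graph $\Gamma$, $N[v]$ denotes the closed neighborhood of $v$ (the vertex $v$ together with all its neighbors). A signed dominating function of $\Gamma$ is a function $g:V(\Gamma)\to\{-1,1\}$ with $\sum_{u\in N[v]}g(u)>0$ for every $v\in V(\Gamma)$; its weight is $\sum_{v\in V(\Gamma)}g(v)$. The signed domination number $\gamma_{S}(\Gamma)$ is the minimum weight of a signed dominating function of $\Gamma$ (the subscript $S$ in $\gamma_S$ is part of the notation and unrelated to the set $S$). $S_3$ is the symmetric group on three letters and $D_8$ is the dihedral group of order $8$. *)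

theory Defs
  imports "HOL-Algebra.Algebra" "Graph_Theory.Pair_Digraph"
begin

text \<open>
  A simple graph is a \<^locale>\<open>pair_graph\<close>: finite vertex set, and a symmetric irreflexive set of
  ordered pairs of vertices as adjacency relation.
\<close>

definition cayley_graph :: "'a set \<Rightarrow> ('a, 'b) monoid_scheme \<Rightarrow> 'a pair_pre_digraph" where
  "cayley_graph S G =
     \<lparr>pverts = carrier G,
      parcs = {(a, b) \<in> carrier G \<times> carrier G. a \<otimes>\<^bsub>G\<^esub> inv\<^bsub>G\<^esub> b \<in> S}\<rparr>"

lemma (in group) pair_graph_cayley_graph:
  assumes "finite (carrier G)" "S \<subseteq> carrier G - {\<one>}" "set_inv S = S"
  shows "pair_graph (cayley_graph S G)"
proof
  show "finite (pverts (cayley_graph S G))"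
    using assms(1) by (simp add: cayley_graph_def)
  show "finite (parcs (cayley_graph S G))"
    by (rule finite_subset[of _ "carrier G \<times> carrier G"])
      (use assms(1) in \<open>auto simp: cayley_graph_def\<close>)
next
  fix e assume "e \<in> parcs (cayley_graph S G)"
  then show "fst e \<in> pverts (cayley_graph S G)" "snd e \<in> pverts (cayley_graph S G)"
    and "fst e \<noteq> snd e"
    using assms(2) by (auto simp: cayley_graph_def)
next
  have "b \<otimes> inv a \<in> S" if "a \<in> carrier G" "b \<in> carrier G" "a \<otimes> inv b \<in> S" for a b
  proof -
    have "inv (a \<otimes> inv b) \<in> S"
      using that(3) assms(3) by (force simp: SET_INV_def)
    then show ?thesis
      using that by (simp add: inv_mult_group)
  qed
  then have "sym (parcs (cayley_graph S G))"
    by (auto simp: cayley_graph_def sym_def)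
  then show "symmetric (with_proj (cayley_graph S G))"
    by (simp add: symmetric_def)
qed

definition closed_neighborhood :: "'a pair_pre_digraph \<Rightarrow> 'a \<Rightarrow> 'a set" where
  "closed_neighborhood \<Gamma> v = insert v {u \<in> pverts \<Gamma>. (v, u) \<in> parcs \<Gamma>}"

definition signed_dominating_function :: "'a pair_pre_digraph \<Rightarrow> ('a \<Rightarrow> int) \<Rightarrow> bool" where
  "signed_dominating_function \<Gamma> g \<longleftrightarrow>
     g \<in> pverts \<Gamma> \<rightarrow> {-1, 1} \<and>
     (\<forall>v \<in> pverts \<Gamma>. (\<Sum>u \<in> closed_neighborhood \<Gamma> v. g u) > 0)"

definition weight :: "'a pair_pre_digraph \<Rightarrow> ('a \<Rightarrow> int) \<Rightarrow> int" where
  "weight \<Gamma> g = (\<Sum>v \<in> pverts \<Gamma>. g v)"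

text \<open>
  For a simple graph (with finitely many vertices) the set below is finite, and it is nonempty
  because the constant function 1 is signed dominating, so the minimum is a genuine one.
\<close>

definition signed_domination_number :: "'a pair_pre_digraph \<Rightarrow> int" where
  "signed_domination_number \<Gamma> = Min {weight \<Gamma> g |g. signed_dominating_function \<Gamma> g}"

lemma (in pair_graph) finite_signed_weights:
  "finite {weight G g |g. signed_dominating_function G g}"
proof (rule finite_subset)
  show "{weight G g |g. signed_dominating_function G g}
      \<subseteq> weight G ` (pverts G \<rightarrow>\<^sub>E {-1, 1})"
  proof clarify
    fix g assume "signed_dominating_function G g"
    then have "restrict g (pverts G) \<in> pverts G \<rightarrow>\<^sub>E {-1, 1}"
      by (simp add: signed_dominating_function_def)
    moreover have "weight G g = weight G (restrict g (pverts G))"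
      by (simp add: weight_def)
    ultimately show "weight G g \<in> weight G ` (pverts G \<rightarrow>\<^sub>E {-1, 1})"
      by blast
  qed
  show "finite (weight G ` (pverts G \<rightarrow>\<^sub>E {-1, 1}))"
    by (intro finite_imageI finite_PiE) (simp_all add: pair_finite_verts)
qed

lemma (in pair_graph) signed_dominating_function_one:
  "signed_dominating_function G (\<lambda>_. 1)"
proof -
  have "finite (closed_neighborhood G v)" "closed_neighborhood G v \<noteq> {}" for v
    by (simp_all add: closed_neighborhood_def pair_finite_verts)
  then show ?thesis
    by (simp add: signed_dominating_function_def card_gt_0_iff)
qed

text \<open>
  The dihedral group of order \<open>2 * n\<close> (so the group written \<open>D\<close> with index 8 is
  \<open>dihedral_group 4\<close>), as the semidirect product of the integers modulo \<open>n\<close> by the inversion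
  action: \<open>(i, False)\<close> is the rotation \<open>r\<close> to the power \<open>i\<close>, and \<open>(i, True)\<close> is that rotation
  times a reflection \<open>s\<close>, where \<open>s\<close> conjugates \<open>r\<close> to its inverse.
\<close>

definition dihedral_group :: "nat \<Rightarrow> (int \<times> bool) monoid" where
  "dihedral_group n =
     \<lparr>carrier = {0..<int n} \<times> UNIV,
      monoid.mult = (\<lambda>(i, a) (j, b). ((if a then i - j else i + j) mod int n, a \<noteq> b)),
      one = (0, False)\<rparr>"

lemma order_dihedral_group: "order (dihedral_group n) = 2 * n"
  by (simp add: order_def dihedral_group_def card_cartesian_product)

lemma group_dihedral_group:
  assumes "n > 0"
  shows "group (dihedral_group n)"
proof (rule groupI)
  fix x assume x: "x \<in> carrier (dihedral_group n)"
  obtain i a where ia: "x = (i, a)" by (cases x)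
  show "\<exists>y \<in> carrier (dihedral_group n). y \<otimes>\<^bsub>dihedral_group n\<^esub> x = \<one>\<^bsub>dihedral_group n\<^esub>"
    by (rule bexI[of _ "((if a then i else - i) mod int n, a)"])
      (use x ia assms in \<open>auto simp: dihedral_group_def mod_simps\<close>)
qed (use assms in \<open>auto simp: dihedral_group_def mod_simps algebra_simps\<close>)

end

theory Submission
  imports Defs
begin

text \<open>
  A connected Cayley graph of valency two is a cycle: for \<open>S = {x, x\<^sup>-\<^sup>1}\<close> the vertices are
  enumerated by the powers of \<open>x\<close>, and for two involutions \<open>x\<close>, \<open>y\<close> by the alternating products
  of \<open>x\<close> and \<open>y\<close>; in the second case the group is dihedral. On a cycle with \<open>n\<close> vertices a
  signed dominating function takes the value -1 at most once on any three consecutive vertices.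
  Summing over all closed neighborhoods, \<open>n \<le> 3 w\<close> for its weight \<open>w\<close>, and as \<open>n - w\<close> is even,
  the minimum is \<open>n - 2 \<lfloor>n / 3\<rfloor>\<close>, attained with the value -1 at every third vertex. This is
  \<open>n - 4\<close> exactly for \<open>n \<in> {6, 7, 8}\<close>.
\<close>

section \<open>Signed domination of cycles\<close>

text \<open>All integers serve as labels, read modulo \<open>n\<close>, so the neighbors of
  \<open>c i\<close> are \<open>c (i - 1)\<close> and \<open>c (i + 1)\<close> without a special
  case where the cycle closes up.\<close>

locale cycle_graph = pair_graph +
  fixes c :: "int \<Rightarrow> 'a" and n :: nat
  assumes n_ge_3: "n \<ge> 3"
    and pverts_eq: "pverts G = range c"
    and c_eq_iff: "c i = c j \<longleftrightarrow> int n dvd j - i"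
    and closed_neighborhood_c: "closed_neighborhood G (c i) = {c (i - 1), c i, c (i + 1)}"
begin

lemma bij_betw_window: "bij_betw c {a..<a + int n} (pverts G)"
proof -
  have "inj_on c {a..<a + int n}"
  proof (rule inj_onI)
    fix i j assume "i \<in> {a..<a + int n}" "j \<in> {a..<a + int n}" "c i = c j"
    then have "int n dvd j - i" "\<bar>j - i\<bar> < int n"
      by (auto simp: c_eq_iff)
    then show "i = j"
      using zdvd_imp_le[of "int n" "\<bar>j - i\<bar>"] by auto
  qed
  moreover have "v \<in> c ` {a..<a + int n}" if v: "v \<in> range c" for v
  proof -
    obtain i where i: "v = c i"
      using v by blast
    have "c i = c (a + (i - a) mod int n)"
      by (simp add: c_eq_iff mod_simps flip: mod_eq_dvd_iff)
    then show ?thesis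
      using i n_ge_3 by auto
  qed
  ultimately show ?thesis
    by (auto simp: bij_betw_def pverts_eq)
qed

text \<open>Every window of \<open>n\<close> consecutive labels meets each vertex once, so the shift
  \<open>d\<close> is free. The shifts -1, 0 and 1 turn sums over neighbors into the weight.\<close>

lemma sum_pverts: "(\<Sum>v\<in>pverts G. f v) = (\<Sum>i\<in>{0..<int n}. f (c (i + d)))"
proof -
  have "(\<Sum>v\<in>pverts G. f v) = (\<Sum>i\<in>{d..<d + int n}. f (c i))"
    by (rule sum.reindex_bij_betw[OF bij_betw_window, symmetric])
  also have "\<dots> = (\<Sum>i\<in>{0..<int n}. f (c (i + d)))"
    by (rule sum.reindex_bij_witness[of _ "\<lambda>i. i + d" "\<lambda>i. i - d"]) auto
  finally show ?thesis .
qed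

lemma card_pverts: "card (pverts G) = n"
  using bij_betw_same_card[OF bij_betw_window[of 0]] by simp

lemma c_shift_neq:
  assumes "0 < \<bar>d\<bar>" "\<bar>d\<bar> < int n"
  shows "c (i + d) \<noteq> c i"
proof
  assume "c (i + d) = c i"
  then have "int n dvd \<bar>d\<bar>"
    by (simp add: c_eq_iff)
  with assms show False
    using zdvd_imp_le[of "int n" "\<bar>d\<bar>"] by linarith
qed

lemma sum_closed_neighborhood:
  "(\<Sum>u\<in>closed_neighborhood G (c i). f u) = f (c (i - 1)) + f (c i) + f (c (i + 1))"
  for f :: "'a \<Rightarrow> int"
proof -
  \<comment> \<open>The labels differ by 1, 1 and 2, all below \<open>n\<close>, so the closed
    neighborhood has three distinct members.\<close>
  have "c (i + 1) \<noteq> c i" "c (i + (- 1)) \<noteq> c i" "c (i - 1 + 2) \<noteq> c (i - 1)"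
    using n_ge_3 by (intro c_shift_neq; simp)+
  then show ?thesis
    unfolding closed_neighborhood_c by (simp add: algebra_simps)
qed

text \<open>Double counting: each closed neighborhood sum is a positive integer, and each vertex
  lies in three of them. The parity holds because each \<open>1 - g v\<close> is 0 or 2.\<close>

lemma weight_bounds:
  assumes "signed_dominating_function G g"
  shows "int n \<le> 3 * weight G g" and "even (int n - weight G g)"
proof -
  have g: "g v = - 1 \<or> g v = 1" if "v \<in> pverts G" for v
    using assms that by (auto simp: signed_dominating_function_def)
  have "int n = (\<Sum>i\<in>{0..<int n}. 1)"
    by simp
  also have "\<dots> \<le> (\<Sum>i\<in>{0..<int n}. g (c (i - 1)) + g (c i) + g (c (i + 1)))"
  proof (rule sum_mono)
    fix i
    have "(\<Sum>u\<in>closed_neighborhood G (c i). g u) > 0"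
      using assms by (auto simp: signed_dominating_function_def pverts_eq)
    then show "1 \<le> g (c (i - 1)) + g (c i) + g (c (i + 1))"
      by (simp add: sum_closed_neighborhood)
  qed
  also have "\<dots> = 3 * weight G g"
    using sum_pverts[of g "- 1"] sum_pverts[of g 0] sum_pverts[of g 1]
    by (simp add: weight_def sum.distrib)
  finally show "int n \<le> 3 * weight G g" .
  have "int n - weight G g = (\<Sum>v\<in>pverts G. 1 - g v)"
    by (simp add: weight_def sum_subtractf card_pverts)
  also have "even \<dots>"
    by (rule dvd_sum) (use g in force)
  finally show "even (int n - weight G g)" .
qed

text \<open>The value -1 goes to the labels 0, 3, ..., \<open>3 * (k - 1)\<close>. As
  \<open>3 * k \<le> n\<close>, the gap from the last of them around the cycle to 0 is at least 3 as
  well.\<close>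

lemma exists_signed_dominating_function:
  "\<exists>g. signed_dominating_function G g \<and> weight G g = int n - 2 * int (n div 3)"
proof -
  define k where "k = int (n div 3)"
  have k: "3 * k \<le> int n" "0 \<le> k"
    unfolding k_def by linarith+
  define T where "T = (\<lambda>j. c (3 * j)) ` {0..<k}"
  define g where "g v = (if v \<in> T then - 1 else 1 :: int)" for v
  have T_sparse: "d = d'"
    if T: "c (i + d) \<in> T" "c (i + d') \<in> T" and d: "\<bar>d - d'\<bar> \<le> 2" for i d d'
  proof -
    obtain j j' where j: "c (i + d) = c (3 * j)" "c (i + d') = c (3 * j')"
      "0 \<le> j" "j < k" "0 \<le> j'" "j' < k"
      using T by (auto simp: T_def)
    then have "int n dvd (3 * j - (i + d)) - (3 * j' - (i + d'))"
      unfolding c_eq_iff by (intro dvd_diff[of _ "_ - _" "_ - _"])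
    also have "(3 * j - (i + d)) - (3 * j' - (i + d')) = 3 * (j - j') - (d - d')"
      by simp
    finally have "int n dvd 3 * (j - j') - (d - d')" .
    \<comment> \<open>The absolute value is at most \<open>3 * (k - 1) + 2\<close>, which is below
      \<open>n\<close>, so divisibility forces it to be 0. Then 3 divides \<open>d - d'\<close>,
      which is at most 2 in absolute value.\<close>
    moreover have "\<bar>j - j'\<bar> \<le> k - 1"
      using j by auto
    then have "\<bar>3 * (j - j') - (d - d')\<bar> < int n"
      using d k(1) by (simp add: abs_if split: if_splits)
    ultimately have "3 * (j - j') = d - d'"
      using zdvd_imp_le[of "int n" "\<bar>3 * (j - j') - (d - d')\<bar>"] by auto
    with d show ?thesis
      by presburger
  qed
  have "(\<Sum>u\<in>closed_neighborhood G (c i). g u) > 0" for i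
    using T_sparse[of i "- 1" 0] T_sparse[of i "- 1" 1] T_sparse[of i 0 1]
    by (auto simp: sum_closed_neighborhood g_def)
  then have "signed_dominating_function G g"
    by (auto simp: signed_dominating_function_def pverts_eq g_def)
  moreover have "weight G g = int n - 2 * k"
  proof -
    have "inj_on (\<lambda>j. c (3 * j)) {0..<k}"
    proof (rule inj_onI)
      fix i j assume ij: "i \<in> {0..<k}" "j \<in> {0..<k}" "c (3 * i) = c (3 * j)"
      then have "3 * i \<in> {0..<0 + int n}" "3 * j \<in> {0..<0 + int n}"
        using k by auto
      then show "i = j"
        using ij(3) inj_onD[OF bij_betw_imp_inj_on[OF bij_betw_window[of 0]]] by fastforce
    qed
    then have T: "int (card T) = k"
      using k by (simp add: T_def card_image)
    have "T \<subseteq> pverts G"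
      by (auto simp: T_def pverts_eq)
    then have "weight G g = (\<Sum>v\<in>pverts G - T. 1) + (\<Sum>v\<in>T. - 1)"
      unfolding weight_def
      by (subst sum.subset_diff[of T])
        (auto simp: g_def pair_finite_verts intro!: arg_cong2[of _ _ _ _ "(+)"] sum.cong)
    also have "\<dots> = int n - 2 * k"
      using T \<open>T \<subseteq> pverts G\<close> card_mono[OF pair_finite_verts \<open>T \<subseteq> pverts G\<close>]
      by (simp add: card_Diff_subset finite_subset[OF _ pair_finite_verts] card_pverts of_nat_diff)
    finally show ?thesis .
  qed
  ultimately show ?thesis
    unfolding k_def by blast
qed

theorem signed_domination_number_cycle:
  "signed_domination_number G = int n - 2 * int (n div 3)"
  unfolding signed_domination_number_def
proof (rule Min_eqI[OF finite_signed_weights])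
  fix w assume "w \<in> {weight G g |g. signed_dominating_function G g}"
  then have "int n \<le> 3 * w" "even (int n - w)"
    using weight_bounds by auto
  \<comment> \<open>With \<open>w = n - 2 * m\<close> for an integer \<open>m\<close>, the first
    bound reads \<open>3 * m \<le> n\<close>.\<close>
  then show "int n - 2 * int (n div 3) \<le> w"
    by presburger
next
  show "int n - 2 * int (n div 3) \<in> {weight G g |g. signed_dominating_function G g}"
    using exists_signed_dominating_function unfolding mem_Collect_eq by metis
qed

end

section \<open>Groups generated by one element or by two involutions\<close>

context group
begin

lemma integer_mod_group_iso:
  assumes x: "x \<in> carrier G" "carrier G = generate G {x}" and "ord x > 0"
  shows "integer_mod_group (ord x) \<cong> G"
proof -
  have "(\<lambda>k. x [^] (k :: int)) \<in> hom (integer_mod_group (ord x)) G"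
    using x by (auto simp: hom_def int_pow_mult[symmetric] int_pow_eq mod_eq_dvd_iff[symmetric])
  moreover have "inj_on (\<lambda>k. x [^] (k :: int)) (carrier (integer_mod_group (ord x)))"
  proof (rule inj_onI)
    fix i j
    assume "i \<in> carrier (integer_mod_group (ord x))" "j \<in> carrier (integer_mod_group (ord x))"
      "x [^] i = x [^] j"
    then show "i = j"
      using x(1) \<open>ord x > 0\<close> zdvd_imp_le[of "int (ord x)" "\<bar>j - i\<bar>"]
      by (fastforce simp: int_pow_eq carrier_integer_mod_group)
  qed
  moreover have "x [^] k \<in> (\<lambda>k. x [^] k) ` carrier (integer_mod_group (ord x))" for k :: int
  proof (rule image_eqI)
    show "x [^] k = x [^] (k mod int (ord x))"
      using x(1) by (simp add: int_pow_eq mod_eq_dvd_iff[symmetric])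
    show "k mod int (ord x) \<in> carrier (integer_mod_group (ord x))"
      using \<open>ord x > 0\<close> by (simp add: carrier_integer_mod_group)
  qed
  then have "(\<lambda>k. x [^] k) ` carrier (integer_mod_group (ord x)) = carrier G"
    using x generate_pow[OF x(1)] by auto
  ultimately show ?thesis
    by (intro is_isoI) (simp add: iso_iff)
qed

end

section \<open>Dihedral normal form relative to two involutions\<close>

locale two_involutions = group +
  fixes x y :: 'a
  assumes x [simp]: "x \<in> carrier G" and y [simp]: "y \<in> carrier G"
    and xx [simp]: "x \<otimes> x = \<one>" and yy [simp]: "y \<otimes> y = \<one>"
    and x_neq_1: "x \<noteq> \<one>" and y_neq_1: "y \<noteq> \<one>" and x_neq_y: "x \<noteq> y"
begin

abbreviation r :: 'a where "r \<equiv> x \<otimes> y"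

text \<open>The normal form of a rotation or reflection. Exponents range over all integers, so the
  product rule involves no reduction modulo the order of \<open>r\<close>.\<close>

definition dih :: "int \<times> bool \<Rightarrow> 'a" where
  "dih = (\<lambda>(i, a). r [^] i \<otimes> (if a then y else \<one>))"

lemma dih_closed [simp]: "dih p \<in> carrier G"
  by (simp add: dih_def split: prod.split)

lemma inv_r: "inv r = y \<otimes> x"
proof -
  have "inv x = x" "inv y = y"
    by (auto intro: inv_equality)
  then show ?thesis
    by (simp add: inv_mult_group)
qed

text \<open>Conjugation by the involution \<open>y\<close> is an endomorphism that sends
  \<open>r\<close> to its inverse, hence every power of \<open>r\<close> to the opposite
  power.\<close>

lemma y_int_pow: "y \<otimes> r [^] (i :: int) = r [^] (- i) \<otimes> y"
proof -
  interpret conj: group_hom G G "\<lambda>z. y \<otimes> z \<otimes> y"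
  proof
    show "(\<lambda>z. y \<otimes> z \<otimes> y) \<in> hom G G"
    proof (rule homI)
      fix u v assume uv: "u \<in> carrier G" "v \<in> carrier G"
      then have "y \<otimes> u \<otimes> y \<otimes> (y \<otimes> v \<otimes> y) = y \<otimes> u \<otimes> (y \<otimes> y) \<otimes> v \<otimes> y"
        by (simp only: m_assoc m_closed y)
      with uv show "y \<otimes> (u \<otimes> v) \<otimes> y = y \<otimes> u \<otimes> y \<otimes> (y \<otimes> v \<otimes> y)"
        by (simp add: m_assoc)
    qed simp
  qed
  have "y \<otimes> r \<otimes> y = inv r"
    by (simp add: inv_r m_assoc)
  then have "y \<otimes> r [^] i \<otimes> y = r [^] (- i)"
    using conj.hom_int_pow[of r i] by (simp add: int_pow_inv int_pow_neg)
  then show ?thesis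
    by (metis int_pow_closed m_assoc m_closed r_one x y yy)
qed

lemma dih_mult: "dih (i, a) \<otimes> dih (j, b) = dih (if a then i - j else i + j, a \<noteq> b)"
proof -
  have *: "y \<otimes> (r [^] j \<otimes> z) = r [^] (- j) \<otimes> (y \<otimes> z)" if "z \<in> carrier G" for z
    using y_int_pow[of j] that by (simp add: int_pow_neg flip: m_assoc)
  show ?thesis
    by (auto simp: dih_def m_assoc * y_int_pow int_pow_mult int_pow_diff int_pow_neg)
qed

text \<open>If \<open>y\<close> were a power of \<open>r\<close>, then \<open>x\<close> and \<open>y\<close> would commute, so \<open>r\<close> would have order 2.\<close>

lemma y_not_power: "y \<noteq> r [^] (k :: int)"
proof
  assume k: "y = r [^] k"
  then have "y \<otimes> r = r \<otimes> y"
    by (metis int_pow_1 int_pow_mult add.commute m_closed x y)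
  then have "y \<otimes> x = x \<otimes> y"
    by (metis m_assoc x y yy r_one m_closed)
  then have "r \<otimes> r = x \<otimes> x \<otimes> (y \<otimes> y)"
    by (metis m_assoc x y m_closed)
  then have "r [^] (2 :: int) = \<one>"
    using int_pow_mult[of r 1 1] by simp
  \<comment> \<open>Since \<open>k mod 2 - k\<close> is even, \<open>k\<close> may be reduced to 0
    or 1. This gives \<open>y = \<one>\<close> or \<open>y = x \<otimes> y\<close>, that is
    \<open>x = \<one>\<close>, both excluded.\<close>
  then have "int (ord r) dvd k mod 2 - k"
    unfolding int_pow_eq_id[OF m_closed[OF x y]] by (rule dvd_trans) presburger
  then have "r [^] k = r [^] (k mod 2)"
    by (simp add: int_pow_eq)
  moreover have "k mod 2 = 0 \<or> k mod 2 = 1"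
    by presburger
  ultimately show False
    using k y_neq_1 x_neq_1 by auto
qed

text \<open>A rotation equal to a reflection would exhibit \<open>y\<close> as a power of
  \<open>r\<close>; within one kind only the exponents modulo the order of \<open>r\<close>
  count.\<close>

lemma dih_eq_iff: "dih (i, a) = dih (j, b) \<longleftrightarrow> a = b \<and> int (ord r) dvd j - i"
proof (cases "a = b")
  case True
  then show ?thesis
    by (auto simp: dih_def int_pow_eq)
next
  case False
  have "r [^] i \<otimes> y \<noteq> r [^] j" for i j :: int
  proof
    assume "r [^] i \<otimes> y = r [^] j"
    then have "y = inv (r [^] i) \<otimes> r [^] j"
      by (metis inv_solve_left int_pow_closed m_closed x y)
    then have "y = r [^] (- i + j)"
      by (simp only: int_pow_mult int_pow_neg m_closed x y)
    with y_not_power show False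
      by blast
  qed
  with False show ?thesis
    by (auto simp: dih_def) metis
qed

lemma dih_x: "dih (1, True) = x" and dih_y: "dih (0, True) = y"
  by (simp_all add: dih_def m_assoc)

lemma dih_hom: "dih \<in> hom (dihedral_group (ord r)) G"
proof (rule homI)
  fix p q assume "p \<in> carrier (dihedral_group (ord r))" "q \<in> carrier (dihedral_group (ord r))"
  obtain i a j b where pq: "p = (i, a)" "q = (j, b)"
    by fastforce
  show "dih (p \<otimes>\<^bsub>dihedral_group (ord r)\<^esub> q) = dih p \<otimes> dih q"
    by (simp add: pq dihedral_group_def dih_mult dih_eq_iff mod_eq_dvd_iff[symmetric])
qed simp

lemma dih_inj:
  assumes "ord r > 0"
  shows "inj_on dih (carrier (dihedral_group (ord r)))"
proof (rule inj_onI)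
  fix p q
  assume "p \<in> carrier (dihedral_group (ord r))" "q \<in> carrier (dihedral_group (ord r))"
    "dih p = dih q"
  then show "p = q"
    using assms zdvd_imp_le[of "int (ord r)" "\<bar>fst q - fst p\<bar>"]
    by (cases p; cases q) (fastforce simp: dih_eq_iff dihedral_group_def)
qed

text \<open>An injection between finite sets of equal size is onto. Stated through the order, this
  covers \<open>sym_group 3\<close> without a proof that the two involutions generate it.\<close>

lemma dihedral_group_iso_if_order:
  assumes "finite (carrier G)" "order G = 2 * ord r"
  shows "dihedral_group (ord r) \<cong> G"
proof -
  have "ord r > 0"
    using ord_ge_1[OF assms(1), of r] by simp
  then have "card (dih ` carrier (dihedral_group (ord r))) = card (carrier G)"
    using assms(2) by (simp add: card_image dih_inj order_dihedral_group flip: order_def)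
  then have "dih ` carrier (dihedral_group (ord r)) = carrier G"
    using assms(1) by (intro card_subset_eq) auto
  then show ?thesis
    using dih_hom dih_inj[OF \<open>ord r > 0\<close>] by (intro is_isoI) (simp add: iso_iff)
qed

text \<open>The image of the homomorphism is a subgroup that contains both generators.\<close>

lemma dih_image:
  assumes "finite (carrier G)" "carrier G = generate G {x, y}"
  shows "dih ` carrier (dihedral_group (ord r)) = carrier G"
proof -
  let ?D = "dihedral_group (ord r)"
  have pos: "ord r > 0"
    using ord_ge_1[OF assms(1), of r] by simp
  interpret D: group_hom ?D G dih
    by (intro group_hom.intro group_hom_axioms.intro group_dihedral_group pos dih_hom is_group)
  \<comment> \<open>Reducing the exponent 1 puts it into the carrier without first showing that
    \<open>r\<close> has order greater than 1.\<close>
  have "dih (1 mod int (ord r), True) = dih (1, True)"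
    unfolding dih_eq_iff by (simp flip: mod_eq_dvd_iff)
  then have "x = dih (1 mod int (ord r), True)"
    by (simp only: dih_x)
  then have "x \<in> dih ` carrier ?D"
    by (rule image_eqI) (use pos in \<open>simp add: dihedral_group_def\<close>)
  moreover have "y \<in> dih ` carrier ?D"
    by (rule image_eqI[where x = "(0, True)"])
      (use pos in \<open>simp_all add: dih_y dihedral_group_def\<close>)
  ultimately have "carrier G \<subseteq> dih ` carrier ?D"
    unfolding assms(2) by (intro generate_subgroup_incl D.img_is_subgroup) auto
  then show ?thesis
    by auto
qed

lemma order_eq_if_generate:
  assumes "finite (carrier G)" "carrier G = generate G {x, y}"
  shows "order G = 2 * ord r"
proof -
  have "card (dih ` carrier (dihedral_group (ord r))) = order (dihedral_group (ord r))"
    using card_image[OF dih_inj] ord_ge_1[OF assms(1), of r] by (simp add: order_def)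
  then show ?thesis
    unfolding dih_image[OF assms] order_dihedral_group by (simp add: order_def)
qed

end

text \<open>The transpositions (1 2) and (2 3) have a 3-cycle as product, and the order 6 is twice
  the order of that product.\<close>

lemma dihedral_group_3_iso_sym_group: "dihedral_group 3 \<cong> sym_group 3"
proof -
  define x y :: "nat \<Rightarrow> nat" where "x = transpose 1 2" and "y = transpose 2 3"
  have "x 2 = 1" "y 2 = 3"
    by (simp_all add: x_def y_def)
  then have "x \<noteq> id" "y \<noteq> id" "x \<noteq> y"
    by auto
  have "(x \<circ> y) 2 = 3"
    by (simp add: x_def y_def transpose_def)
  then have r: "x \<circ> y \<noteq> id"
    by (metis eq_id_iff numeral_eq_iff semiring_norm(88))
  have "x permutes {1..3}" "y permutes {1..3}"
    unfolding x_def y_def by (intro permutes_swap_id; simp)+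
  with \<open>x \<noteq> id\<close> \<open>y \<noteq> id\<close> \<open>x \<noteq> y\<close>
  interpret two_involutions "sym_group 3" x y
    by (intro two_involutions.intro two_involutions_axioms.intro sym_group_is_group)
      (simp_all add: sym_group_def x_def y_def)
  have "(x \<circ> y) \<circ> (x \<circ> y) \<circ> (x \<circ> y) = id"
    by (auto simp: x_def y_def fun_eq_iff transpose_def)
  then have "r [^]\<^bsub>sym_group 3\<^esub> (3 :: nat) = \<one>\<^bsub>sym_group 3\<^esub>"
    by (simp add: numeral_3_eq_3 sym_group_def)
  then have "ord r dvd 3"
    by (simp add: pow_eq_id)
  moreover have "ord r \<noteq> 1"
    unfolding ord_eq_1[OF m_closed[OF x y]] using r by (simp add: sym_group_mult sym_group_one)
  moreover have "d = 3" if "d dvd 3" "d \<noteq> 1" for d :: nat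
  proof -
    have "d \<noteq> 0" "d \<noteq> 2" "d \<le> 3"
      using that dvd_imp_le[of d 3] by (auto intro: Nat.gr0I)
    then show ?thesis
      using that(2) by linarith
  qed
  ultimately have "ord r = 3"
    by blast
  moreover have "order (sym_group 3) = 6"
    using card_permutations[of "{1..3 :: nat}" 3] by (simp add: order_def sym_group_def fact_numeral)
  ultimately show ?thesis
    using dihedral_group_iso_if_order finite_permutations[of "{1..3 :: nat}"]
    by (simp add: sym_group_def)
qed

section \<open>Cayley graphs of valency two\<close>

context group
begin

text \<open>Symmetry of \<open>S\<close> turns the condition on \<open>v \<otimes> inv u\<close>
  into one on \<open>u \<otimes> inv v\<close>, so the neighbors arise by left multiplication with
  members of \<open>S\<close>.\<close>

lemma closed_neighborhood_cayley_graph: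
  assumes S: "S \<subseteq> carrier G" "set_inv S = S" and v: "v \<in> carrier G"
  shows "closed_neighborhood (cayley_graph S G) v = insert v ((\<lambda>s. s \<otimes> v) ` S)"
proof -
  have "v \<otimes> inv u \<in> S \<longleftrightarrow> u \<otimes> inv v \<in> S" if "u \<in> carrier G" for u
  proof -
    have "inv s \<in> S" if "s \<in> S" for s
      using S(2) that by (force simp: SET_INV_def)
    then have "inv (a \<otimes> inv b) \<in> S" if "a \<otimes> inv b \<in> S" for a b
      using that by blast
    then show ?thesis
      using v \<open>u \<in> carrier G\<close> by (metis inv_closed inv_inv inv_mult_group)
  qed
  moreover have "u \<in> (\<lambda>s. s \<otimes> v) ` S \<longleftrightarrow> u \<otimes> inv v \<in> S" if u: "u \<in> carrier G" for u
  proof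
    assume "u \<in> (\<lambda>s. s \<otimes> v) ` S"
    then show "u \<otimes> inv v \<in> S"
      using S v by (auto simp: m_assoc subset_iff)
  next
    assume "u \<otimes> inv v \<in> S"
    moreover have "u = u \<otimes> inv v \<otimes> v"
      using u v by (simp add: m_assoc)
    ultimately show "u \<in> (\<lambda>s. s \<otimes> v) ` S"
      by (rule rev_image_eqI)
  qed
  moreover have "(\<lambda>s. s \<otimes> v) ` S \<subseteq> carrier G"
    using S v by auto
  ultimately show ?thesis
    using v by (auto simp: closed_neighborhood_def cayley_graph_def)
qed

text \<open>Reduces both kinds of groups to a cyclic labelling \<open>c\<close>. In
  \<open>step\<close> only the unordered pair is fixed, since which generator moves forward may vary
  with \<open>i\<close>.\<close>

lemma signed_domination_number_cayley_graph:
  assumes fin: "finite (carrier G)" and xy: "{x, y} \<subseteq> carrier G - {\<one>}" "x \<noteq> y"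
    and sym: "set_inv {x, y} = {x, y}"
    and c: "range c = carrier G" "\<And>i j. c i = c j \<longleftrightarrow> int (order G) dvd j - i"
    and step: "\<And>i. {x \<otimes> c i, y \<otimes> c i} = {c (i - 1), c (i + 1)}"
  shows "signed_domination_number (cayley_graph {x, y} G) = int (order G) - 2 * int (order G div 3)"
proof -
  interpret pair_graph "cayley_graph {x, y} G"
    by (rule pair_graph_cayley_graph[OF fin xy(1) sym])
  interpret cycle_graph "cayley_graph {x, y} G" c "order G"
  proof
    have "card {\<one>, x, y} \<le> order G"
      unfolding order_def using xy fin by (intro card_mono) auto
    then show "order G \<ge> 3"
      using xy by auto
    show "pverts (cayley_graph {x, y} G) = range c"
      by (simp add: cayley_graph_def c)
    show "closed_neighborhood (cayley_graph {x, y} G) (c i) = {c (i - 1), c i, c (i + 1)}" for i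
      using closed_neighborhood_cayley_graph[of "{x, y}" "c i"] xy sym c(1) step[of i] by auto
  qed (rule c(2))
  show ?thesis
    by (rule signed_domination_number_cycle)
qed

lemma generate_insert_inv:
  assumes "x \<in> carrier G"
  shows "generate G {x, inv x} = generate G {x}"
proof
  show "generate G {x, inv x} \<subseteq> generate G {x}"
    using assms generate_is_subgroup[of "{x}"]
    by (intro generate_subgroup_incl) (auto intro: generate.intros)
qed (simp add: mono_generate)

lemma signed_domination_number_cayley_graph_cyclic:
  assumes fin: "finite (carrier G)" and x: "x \<in> carrier G" "x \<noteq> \<one>" "x \<noteq> inv x"
    and gen: "carrier G = generate G {x}"
  shows "signed_domination_number (cayley_graph {x, inv x} G)
    = int (order G) - 2 * int (order G div 3)"
proof (rule signed_domination_number_cayley_graph[OF fin, of _ _ "\<lambda>i. x [^] (i :: int)"])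
  show "set_inv {x, inv x} = {x, inv x}"
    using x(1) by (auto simp: SET_INV_def)
  show "x [^] i = x [^] j \<longleftrightarrow> int (order G) dvd j - i" for i j :: int
    using x(1) generate_pow_card[OF x(1)] gen by (simp add: int_pow_eq order_def)
  show "{x \<otimes> x [^] i, inv x \<otimes> x [^] i} = {x [^] (i - 1), x [^] (i + 1)}" for i :: int
    using int_pow_mult[OF x(1), of 1 i] int_pow_mult[OF x(1), of "- 1" i] x(1)
    by (auto simp: int_pow_neg add.commute)
  show "range (\<lambda>i. x [^] (i :: int)) = carrier G"
    using generate_pow[OF x(1)] gen by auto
qed (use x in auto)

end

context two_involutions
begin

lemma signed_domination_number_cayley_graph_involutions:
  assumes fin: "finite (carrier G)" and gen: "carrier G = generate G {x, y}"
  shows "signed_domination_number (cayley_graph {x, y} G)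
    = int (order G) - 2 * int (order G div 3)"
proof (rule signed_domination_number_cayley_graph[OF fin])
  \<comment> \<open>the walk \<open>\<one>\<close>, \<open>y\<close>, \<open>x y\<close>, \<open>y x y\<close>, ... around the cycle, where \<open>y r\<^sup>k = r\<^sup>-\<^sup>k y\<close>\<close>
  define c where "c i = dih (if even i then i div 2 else - (i div 2), odd i)" for i
  note order = order_eq_if_generate[OF fin gen]
  have "inv x = x" "inv y = y"
    by (auto intro: inv_equality)
  then show "set_inv {x, y} = {x, y}"
    by (auto simp: SET_INV_def)
  have c_even: "c (2 * k) = dih (k, False)" and c_odd: "c (2 * k + 1) = dih (- k, True)" for k
    by (simp_all add: c_def)
  have parity: "(\<exists>k. i = 2 * k) \<or> (\<exists>k. i = 2 * k + 1)" for i :: int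
    by presburger
  show "c i = c j \<longleftrightarrow> int (order G) dvd j - i" for i j
  \<comment> \<open>For labels of equal parity with \<open>j = i + 2 * d\<close> the exponents
    differ by \<open>d\<close> or \<open>- d\<close>. Labels of different parity name a rotation and
    a reflection, and the even order of the group cannot divide their odd difference.\<close>
  proof (cases "even i = even j")
    case True
    then have "j = i + 2 * ((j - i) div 2)"
      by presburger
    then obtain d where d: "j = i + 2 * d"
      by blast
    have "int (order G) dvd j - i \<longleftrightarrow> int (ord r) dvd d"
      by (simp add: d order)
    also have "\<dots> \<longleftrightarrow> c i = c j"
      by (auto simp: c_def d dih_eq_iff)
    finally show ?thesis ..
  next
    case False
    then have "odd (j - i)"
      by simp
    then have "\<not> int (order G) dvd j - i"
      unfolding order by (auto dest: dvd_mult_left)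
    then show ?thesis
      using False by (simp add: c_def dih_eq_iff)
  qed
  \<comment> \<open>At an even label \<open>y\<close> steps forward and \<open>x\<close> back; at an
    odd label they exchange these roles.\<close>
  show "{x \<otimes> c i, y \<otimes> c i} = {c (i - 1), c (i + 1)}" for i
    using parity[of i]
  proof (elim disjE exE)
    fix k assume i: "i = 2 * k"
    have "x \<otimes> c i = dih (1, True) \<otimes> dih (k, False)" "y \<otimes> c i = dih (0, True) \<otimes> dih (k, False)"
      by (simp_all only: i c_even dih_x dih_y)
    then show ?thesis
      using c_odd[of "k - 1"] c_odd[of k] by (simp add: i dih_mult)
  next
    fix k assume i: "i = 2 * k + 1"
    have "x \<otimes> c i = dih (1, True) \<otimes> dih (- k, True)" "y \<otimes> c i = dih (0, True) \<otimes> dih (- k, True)"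
      by (simp_all only: i c_odd dih_x dih_y)
    then show ?thesis
      using c_even[of "k + 1"] c_even[of k] by (auto simp: i dih_mult algebra_simps)
  qed
  have "dih (k, a) \<in> range c" for k a
    using rangeI[of c "2 * k"] rangeI[of c "2 * (- k) + 1"] unfolding c_even c_odd
    by (cases a) simp_all
  then have "range dih \<subseteq> range c"
    by auto
  moreover have "range c \<subseteq> carrier G"
    by (auto simp: c_def)
  ultimately show "range c = carrier G"
    using dih_image[OF fin gen] by blast
qed (use x_neq_1 y_neq_1 x_neq_y in auto)

end

section \<open>Cyclic or dihedral type and comparison of orders\<close>

theorem theorem3p9:
  fixes G :: "('a, 'b) monoid_scheme" and S :: "'a set" and n :: nat
  assumes "group G"
    and "finite (carrier G)"
    and "order G = n"
    and "S \<subseteq> carrier G - {\<one>\<^bsub>G\<^esub>}"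
    and "S = set_inv\<^bsub>G\<^esub> S"
    and "carrier G = generate G S"
    and "card S = 2"
  shows "signed_domination_number (cayley_graph S G) = int n - 4 \<longleftrightarrow>
    G \<cong> integer_mod_group 6 \<or> G \<cong> integer_mod_group 7 \<or> G \<cong> integer_mod_group 8 \<or>
    G \<cong> sym_group 3 \<or> G \<cong> dihedral_group 4"
proof -
  interpret group G by fact
  obtain x y where S: "S = {x, y}" and "x \<noteq> y"
    using \<open>card S = 2\<close> by (auto simp: card_2_iff)
  have xy: "x \<in> carrier G" "x \<noteq> \<one>\<^bsub>G\<^esub>" "y \<in> carrier G" "y \<noteq> \<one>\<^bsub>G\<^esub>"
    using assms(4) S by auto
  have inv_in: "inv\<^bsub>G\<^esub> s \<in> {x, y}" if "s \<in> {x, y}" for s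
    using assms(5) that unfolding S SET_INV_def by blast
  have *: "signed_domination_number (cayley_graph S G) = int n - 2 * int (n div 3) \<and>
    (G \<cong> integer_mod_group n \<or> (\<exists>m. n = 2 * m \<and> G \<cong> dihedral_group m))"
  \<comment> \<open>Inversion permutes the two-element set \<open>S\<close>: if it swaps
    \<open>x\<close> and \<open>y\<close>, the group is cyclic; if it fixes both, they are
    involutions and the group is dihedral.\<close>
  proof (cases "inv\<^bsub>G\<^esub> x = y")
    case True
    then have gen: "carrier G = generate G {x}"
      using assms(6) S generate_insert_inv[OF xy(1)] by simp
    then have "ord x = n"
      using generate_pow_card[OF xy(1)] assms(3) by (simp add: order_def)
    moreover have "ord x > 0"
      using ord_ge_1[OF assms(2) xy(1)] by simp
    ultimately have "G \<cong> integer_mod_group n"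
      using integer_mod_group_iso[OF xy(1) gen] group.iso_sym[OF group_integer_mod_group] by blast
    then show ?thesis
      using signed_domination_number_cayley_graph_cyclic[OF assms(2) xy(1,2) _ gen]
        True S \<open>x \<noteq> y\<close> assms(3) by auto
  next
    case False
    have "inv\<^bsub>G\<^esub> x = x" "inv\<^bsub>G\<^esub> y = y"
      using inv_in[of x] inv_in[of y] False xy by auto
    then have "x \<otimes>\<^bsub>G\<^esub> x = \<one>\<^bsub>G\<^esub>" "y \<otimes>\<^bsub>G\<^esub> y = \<one>\<^bsub>G\<^esub>"
      using xy by (metis r_inv)+
    then interpret two_involutions G x y
      using xy \<open>x \<noteq> y\<close> by unfold_locales
    have gen: "carrier G = generate G {x, y}"
      using assms(6) S by simp
    have "n = 2 * ord r"
      using order_eq_if_generate[OF assms(2) gen] assms(3) by simp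
    moreover have "G \<cong> dihedral_group (ord r)"
      using dihedral_group_iso_if_order[OF assms(2) order_eq_if_generate[OF assms(2) gen]]
        group.iso_sym[OF group_dihedral_group, of "ord r" G] ord_ge_1[OF assms(2), of r] by simp
    ultimately show ?thesis
      using signed_domination_number_cayley_graph_involutions[OF assms(2) gen] S assms(3) by auto
  qed
  \<comment> \<open>Isomorphic groups have equal order, so the list of groups determines the
    possible \<open>n\<close>.\<close>
  have "n \<in> {6, 7, 8}"
    if "G \<cong> integer_mod_group 6 \<or> G \<cong> integer_mod_group 7 \<or> G \<cong> integer_mod_group 8 \<or>
      G \<cong> sym_group 3 \<or> G \<cong> dihedral_group 4"
  proof -
    have "order (integer_mod_group k) = k" if "k > 0" for k
      using that by (simp add: order_def carrier_integer_mod_group)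
    moreover have "order (sym_group 3) = 6"
      using iso_same_card[OF dihedral_group_3_iso_sym_group] order_dihedral_group[of 3]
      by (simp add: order_def)
    moreover have "card (carrier G) = n"
      using assms(3) by (simp add: order_def)
    ultimately show ?thesis
      using that order_dihedral_group[of 4] unfolding order_def
      by (elim disjE) (drule iso_same_card, simp)+
  qed
  moreover have "G \<cong> integer_mod_group 6 \<or> G \<cong> integer_mod_group 7 \<or> G \<cong> integer_mod_group 8 \<or>
      G \<cong> sym_group 3 \<or> G \<cong> dihedral_group 4" if n: "n \<in> {6, 7, 8}"
  proof -
    \<comment> \<open>The dihedral type makes \<open>n\<close> even, which leaves orders 6 and 8;
      for \<open>n = 7\<close> only the cyclic type remains.\<close>
    have "G \<cong> integer_mod_group 6 \<or> G \<cong> integer_mod_group 7 \<or> G \<cong> integer_mod_group 8 \<or>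
      G \<cong> dihedral_group 3 \<or> G \<cong> dihedral_group 4"
      using conjunct2[OF *]
    proof (elim disjE exE conjE)
      fix m assume "n = 2 * m" "G \<cong> dihedral_group m"
      moreover from \<open>n = 2 * m\<close> n have "m = 3 \<or> m = 4"
        by auto
      ultimately show ?thesis
        by blast
    qed (use n in blast)
    then show ?thesis
      using iso_trans[OF _ dihedral_group_3_iso_sym_group, of G] by blast
  qed
  moreover have "int n - 2 * int (n div 3) = int n - 4 \<longleftrightarrow> n \<in> {6, 7, 8}"
    by auto
  ultimately show ?thesis
    using * by auto
qed

end
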